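(* Let $p$ be a prime, let $k$ and $n$ be positive integers, let $(\mathcal{C},L)$ be a configuration of order $k$ modulo $p$ (that is, $\mathcal{C}\subset 2^{[k]}$ and $L\subset\mathbb{F}_p$), and let $\Delta=\Delta(\mathcal{C})$ be the maximum degree of $\mathcal{C}$. If $\mathcal{F}\subset 2^{[n]}$ is $(\mathcal{C},L)$-satisfying, then $$|\mathcal{F}|\leq (k-1)\sum_{s=0}^{\Delta|L|}\binom{n}{s}.$$
   Context: Here $[m]=\{1,\dots,m\}$ and $2^{[m]}$ is the set of all subsets of $[m]$. Sizes of sets are regarded as residues modulo $p$ when asking whether they belong to $L\subset\mathbb{F}_p$. A configuration of order $k$ modulo $p$ is a pair $(\mathcal{C},L)$, where $\mathcal{C}\subset 2^{[k]}$ and $L\subset\mathbb{F}_p$. A family $\mathcal{F}\subset 2^{[n]}$ is $(\mathcal{C},L)$-satisfying if $|A|\notin L$ for every $A\in\mathcal{F}$, but there exist no $k$ distinct sets $A_1,\dots,A_k\in\mathcal{F}$ such that $\left|\bigcap_{i\in X}A_i\right|\notin L$ for every $X\in\mathcal{C}$. The degree $\deg_{\mathcal{C}}(a)$ of $a\in[k]$ is the number of sets in $\mathcal{C}$ containing $a$, and the maximum degree of $\mathcal{C}$ is $\Delta(\mathcal{C})=\max_{a\in[k]}\deg_{\mathcal{C}}(a)$.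
   Formalization: If the empty set belongs to C, the undefined empty intersection is taken to impose no condition; reading it as [n] or as the empty set makes the bound false (p=2, L={0}, k=n=2, C={∅}, F={{1},{2}}). *)

theory Defs
  imports Complex_Main "HOL-Computational_Algebra.Primes"
begin

text \<open>
  The elements of the field with \<open>p\<close> elements are represented by the residues \<open>{0..<p}\<close>, so that
  a set \<open>A\<close> has its size in \<open>L\<close> iff \<open>card A mod p \<in> L\<close>, and \<open>card L\<close> is the number of
  residue classes in \<open>L\<close>. The set \<open>[m]\<close> is \<open>{1..m}\<close>.
\<close>

definition configuration :: "nat \<Rightarrow> nat \<Rightarrow> nat set set \<Rightarrow> nat set \<Rightarrow> bool" where
  "configuration p k C L \<longleftrightarrow> C \<subseteq> Pow {1..k} \<and> L \<subseteq> {0..<p}"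

text \<open>
  A choice of \<open>k\<close> distinct members of \<open>F\<close> is a map that is injective on \<open>{1..k}\<close>.
  An intersection with empty index set imposes no condition. (Evaluating it as the ground set, or
  as the empty set, would make the bound on satisfying families fail for trivial reasons: with
  \<open>C = {{}}\<close> the maximum degree is 0, but if the size of the empty intersection lies
  in \<open>L\<close>, then every family of sets with sizes outside \<open>L\<close> would be satisfying.)
\<close>

definition satisfying ::
  "nat \<Rightarrow> nat \<Rightarrow> nat set set \<Rightarrow> nat set \<Rightarrow> nat set set \<Rightarrow> bool" where
  "satisfying p k C L F \<longleftrightarrow>
     (\<forall>A\<in>F. card A mod p \<notin> L) \<and>
     \<not> (\<exists>A :: nat \<Rightarrow> nat set. (\<forall>i\<in>{1..k}. A i \<in> F) \<and> inj_on A {1..k} \<and>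
          (\<forall>X\<in>C. X \<noteq> {} \<longrightarrow> card (\<Inter>i\<in>X. A i) mod p \<notin> L))"

definition degree :: "nat set set \<Rightarrow> nat \<Rightarrow> nat" where
  "degree C a = card {X \<in> C. a \<in> X}"

definition max_degree :: "nat \<Rightarrow> nat set set \<Rightarrow> nat" where
  "max_degree k C = Max (degree C ` {1..k})"

end

theory Submission
  imports Defs "HOL-Number_Theory.Cong" "HOL-Library.FuncSet" "HOL-Library.Disjoint_Sets"
begin

text \<open>
  The idea is a multilinear exchange argument over the field with \<open>p\<close> elements. The product
  \<open>T (A\<^sub>1, \<dots>, A\<^sub>k)\<close> of \<open>card (\<Inter>i\<in>X. A\<^sub>i) - l\<close> over all nonempty \<open>X \<in> C\<close> and all \<open>l \<in> L\<close> is
  nonzero modulo \<open>p\<close> exactly when no intersection has its size in \<open>L\<close>. So \<open>T\<close> is nonzero on the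
  diagonal of a satisfying family, and it remains to show that a function \<open>T\<close> of this kind which is
  nonzero on the diagonal of a large family is also nonzero at some \<open>k\<close>-tuple of distinct members.

  As a function of a single argument, \<open>T\<close> is a polynomial of degree at most \<open>d = \<Delta> * card L\<close> in the
  indicator variables of the ground elements, because that argument occurs in at most \<open>\<Delta>\<close> of the
  intersections. Hence \<open>T\<close> depends linearly on the vector of the numbers \<open>of_bool (S \<subseteq> A)\<close> with
  \<open>card S \<le> d\<close>, which has \<open>D = (\<Sum>s\<le>d. n choose s)\<close> coordinates.

  Any family contains at most \<open>D\<close> members whose vectors span all the others modulo \<open>p\<close>
  (\<open>small_spanning_subset\<close>). If a family has more than \<open>(k - 1) * D\<close> members, such spanning sets
  \<open>I\<^sub>1, \<dots>, I\<^sub>k\<^sub>-\<^sub>1\<close> can be removed one after another and some member \<open>A\<close> is left over; it lies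
  in the span of every \<open>I\<^sub>j\<close> (\<open>disjoint_spanning_subsets\<close>). Starting from the diagonal tuple
  \<open>(A, \<dots>, A)\<close>, linearity allows the \<open>j\<close>-th argument to be exchanged for some element of \<open>I\<^sub>j\<close>
  with \<open>T\<close> still nonzero (\<open>nonzero_at_spanning_set\<close>). After \<open>k - 1\<close> exchanges all arguments are
  distinct, since the \<open>I\<^sub>j\<close> are disjoint and avoid \<open>A\<close>.
\<close>

section \<open>Spanning sets modulo a prime\<close>

definition spanned_mod :: "int \<Rightarrow> 's set \<Rightarrow> ('a \<Rightarrow> 's \<Rightarrow> int) \<Rightarrow> 'a set \<Rightarrow> 'a \<Rightarrow> bool" where
  "spanned_mod p J v I A \<longleftrightarrow> (\<exists>c. \<forall>S\<in>J. [v A S = (\<Sum>B\<in>I. c B * v B S)] (mod p))"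

definition dependent_mod :: "int \<Rightarrow> 's set \<Rightarrow> ('a \<Rightarrow> 's \<Rightarrow> int) \<Rightarrow> 'a set \<Rightarrow> bool" where
  "dependent_mod p J v I \<longleftrightarrow>
     (\<exists>c. (\<exists>B\<in>I. \<not> p dvd c B) \<and> (\<forall>S\<in>J. p dvd (\<Sum>B\<in>I. c B * v B S)))"

text \<open>
  There are \<open>p ^ card I\<close> coefficient vectors with entries in \<open>{0..<p}\<close> but only \<open>p ^ card J\<close>
  possible values of the combination modulo \<open>p\<close>. So two coefficient vectors give the same value,
  and their difference is a dependency. This replaces elimination over the field.
\<close>

lemma dependent_mod_if_card_gt:
  assumes "p > 1" "finite I" "finite J" "card J < card I"
  shows "dependent_mod p J v I"
proof -
  define g where "g c = (\<lambda>S\<in>J. (\<Sum>B\<in>I. c B * v B S) mod p)" for c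
  let ?P = "I \<rightarrow>\<^sub>E {0..<p}" and ?Q = "J \<rightarrow>\<^sub>E {0..<p}"
  have "g ` ?P \<subseteq> ?Q"
    using assms(1) by (auto simp: g_def)
  moreover have "card ?Q < card ?P"
    using assms by (simp add: card_PiE)
  moreover have "finite ?Q"
    using assms by (intro finite_PiE) auto
  ultimately have "\<not> inj_on g ?P"
    using card_inj_on_le[of g ?P ?Q] by auto
  then obtain a b where ab: "a \<in> ?P" "b \<in> ?P" "g a = g b" "a \<noteq> b"
    by (auto simp: inj_on_def)
  then obtain B where B: "B \<in> I" "a B \<noteq> b B"
    by (metis PiE_ext)
  have "a B \<in> {0..<p}" "b B \<in> {0..<p}"
    using ab B by auto
  then have "\<not> p dvd a B - b B"
    using B by (auto simp flip: mod_eq_dvd_iff)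
  moreover have "p dvd (\<Sum>B\<in>I. (a B - b B) * v B S)" if "S \<in> J" for S
  proof -
    have "(\<Sum>B\<in>I. a B * v B S) mod p = (\<Sum>B\<in>I. b B * v B S) mod p"
      using fun_cong[OF ab(3), of S] that by (simp add: g_def)
    then show ?thesis
      by (simp add: mod_eq_dvd_iff left_diff_distrib sum_subtractf)
  qed
  ultimately show ?thesis
    unfolding dependent_mod_def using B(1) by (intro exI[of _ "\<lambda>B. a B - b B"]) auto
qed

lemma spanned_mod_member:
  assumes "finite I" "A \<in> I"
  shows "spanned_mod p J v I A"
  unfolding spanned_mod_def
proof (intro exI ballI)
  fix S
  have "(\<Sum>B\<in>I. of_bool (B = A) * v B S) = (\<Sum>B\<in>I. if B = A then v A S else 0)"
    by (intro sum.cong) auto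
  then show "[v A S = (\<Sum>B\<in>I. of_bool (B = A) * v B S)] (mod p)"
    using assms by simp
qed

text \<open>
  In a dependency of \<open>insert A I\<close> the coefficient of \<open>A\<close> must be nonzero modulo \<open>p\<close>, as otherwise
  \<open>I\<close> itself would be dependent; primality makes it invertible, so the dependency can be solved
  for \<open>A\<close>.
\<close>

lemma spanned_mod_if_dependent_insert:
  fixes p :: int
  assumes "prime p" "finite I" "A \<notin> I" "\<not> dependent_mod p J v I"
    and "dependent_mod p J v (insert A I)"
  shows "spanned_mod p J v I A"
proof -
  obtain c where c: "\<exists>B\<in>insert A I. \<not> p dvd c B"
    "\<And>S. S \<in> J \<Longrightarrow> p dvd c A * v A S + (\<Sum>B\<in>I. c B * v B S)"
    using assms by (auto simp: dependent_mod_def)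
  have "\<not> p dvd c A"
  proof
    assume cA: "p dvd c A"
    then have "p dvd (\<Sum>B\<in>I. c B * v B S)" if "S \<in> J" for S
      using c(2)[OF that] by (simp add: dvd_add_right_iff)
    then show False
      using assms(4) c(1) cA by (auto simp: dependent_mod_def)
  qed
  then have "coprime (c A) p"
    using assms(1) by (metis coprime_commute prime_imp_coprime)
  then obtain u where u: "[c A * u = 1] (mod p)"
    using cong_solve_coprime_int by blast
  have "[v A S = (\<Sum>B\<in>I. (- u * c B) * v B S)] (mod p)" if "S \<in> J" for S
  proof -
    let ?s = "\<Sum>B\<in>I. c B * v B S"
    have "p dvd u * (c A * v A S + ?s) - (c A * u - 1) * v A S"
      using dvd_diff[OF dvd_mult[OF c(2)[OF that], of u] dvd_mult2] u
      by (simp add: cong_iff_dvd_diff)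
    also have "u * (c A * v A S + ?s) - (c A * u - 1) * v A S = v A S - (- u * ?s)"
      by (simp add: algebra_simps)
    also have "- u * ?s = (\<Sum>B\<in>I. (- u * c B) * v B S)"
      by (simp only: sum_distrib_left mult.assoc)
    finally show ?thesis
      by (simp add: cong_iff_dvd_diff)
  qed
  then show ?thesis
    unfolding spanned_mod_def by (intro exI[of _ "\<lambda>B. - u * c B"]) auto
qed

lemma small_spanning_subset:
  fixes p :: int
  assumes "prime p" "finite F" "finite J"
  obtains I where "I \<subseteq> F" "card I \<le> card J" "\<And>A. A \<in> F \<Longrightarrow> spanned_mod p J v I A"
proof -
  let ?ind = "\<lambda>I. I \<subseteq> F \<and> \<not> dependent_mod p J v I"
  have "?ind {}"
    by (auto simp: dependent_mod_def)
  moreover have "\<forall>I. ?ind I \<longrightarrow> card I < Suc (card F)"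
    using assms(2) by (auto simp: less_Suc_eq_le intro: card_mono)
  ultimately have "\<exists>I. ?ind I \<and> (\<forall>I'. ?ind I' \<longrightarrow> card I' \<le> card I)"
    by (rule ex_has_greatest_nat)
  then obtain I where I: "?ind I" and max: "\<And>I'. ?ind I' \<Longrightarrow> card I' \<le> card I"
    by auto
  have fin: "finite I"
    using I assms(2) finite_subset by blast
  have "card I \<le> card J"
    using dependent_mod_if_card_gt[OF prime_gt_1_int[OF assms(1)] fin assms(3), of v] I
    by (meson not_le)
  moreover have "spanned_mod p J v I A" if "A \<in> F" for A
  proof (cases "A \<in> I")
    case True
    then show ?thesis
      using fin by (rule spanned_mod_member[rotated])
  next
    case False
    then have "dependent_mod p J v (insert A I)"
      using max[of "insert A I"] that I fin by auto
    then show ?thesis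
      using spanned_mod_if_dependent_insert[OF assms(1) fin False] I by blast
  qed
  ultimately show ?thesis
    using I that by blast
qed

text \<open>
  Each removal of a small spanning set costs at most \<open>card J\<close> members, so something is left after
  \<open>m\<close> removals. A leftover member belonged to the family at every stage, hence is spanned by every
  removed set.
\<close>

lemma disjoint_spanning_subsets:
  fixes p :: int
  assumes "prime p" "finite J"
  shows "finite F \<Longrightarrow> card F > m * card J \<Longrightarrow>
    \<exists>A\<in>F. \<exists>I. (\<forall>j\<in>{1..m}. I j \<subseteq> F - {A} \<and> spanned_mod p J v (I j) A) \<and>
      disjoint_family_on I {1..m}"
proof (induction m arbitrary: F)
  case 0
  then have "F \<noteq> {}"
    by auto
  then show ?case
    by (auto simp: disjoint_family_on_def)
next
  case (Suc m)
  obtain I0 where I0: "I0 \<subseteq> F" "card I0 \<le> card J" "\<And>A. A \<in> F \<Longrightarrow> spanned_mod p J v I0 A"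
    using small_spanning_subset[OF assms(1) Suc.prems(1) assms(2)] by blast
  have "card (F - I0) = card F - card I0"
    using I0(1) Suc.prems(1) by (simp add: card_Diff_subset finite_subset)
  then have "card (F - I0) > m * card J"
    using Suc.prems(2) I0(2) by simp
  then obtain A I where AI: "A \<in> F - I0"
      "\<forall>j\<in>{1..m}. I j \<subseteq> (F - I0) - {A} \<and> spanned_mod p J v (I j) A"
      "disjoint_family_on I {1..m}"
    using Suc.IH[of "F - I0"] Suc.prems(1) by auto
  let ?I = "I(Suc m := I0)"
  have "\<forall>j\<in>{1..Suc m}. ?I j \<subseteq> F - {A} \<and> spanned_mod p J v (?I j) A"
    using AI(1,2) I0(1,3) by (auto simp: le_Suc_eq)
  moreover have "disjoint_family_on ?I {1..Suc m}"
  proof -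
    have "disjoint_family_on ?I {1..m}"
      using AI(3) by (simp add: disjoint_family_on_def)
    moreover have "?I (Suc m) \<inter> (\<Union>j\<in>{1..m}. ?I j) = {}"
      using AI(2) by fastforce
    ultimately show ?thesis
      by (simp add: atLeastAtMostSuc_conv disjoint_family_on_insert)
  qed
  ultimately show ?case
    using AI(1) by blast
qed

section \<open>The exchange argument\<close>

text \<open>
  The value \<open>f A\<close> is the same combination, modulo \<open>p\<close>, of the values \<open>f B\<close> as the vector of \<open>A\<close> is
  of the vectors of the \<open>B\<close>. Not all of these values can vanish if \<open>f A\<close> does not.
\<close>

lemma nonzero_at_spanning_set:
  fixes p :: int
  assumes lin: "\<And>B. B \<in> insert A I \<Longrightarrow> f B = (\<Sum>S\<in>J. w S * v B S)"
    and span: "spanned_mod p J v I A" and nz: "\<not> p dvd f A"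
  shows "\<exists>B\<in>I. \<not> p dvd f B"
proof (rule ccontr)
  assume "\<not> (\<exists>B\<in>I. \<not> p dvd f B)"
  then have zero: "p dvd f B" if "B \<in> I" for B
    using that by blast
  obtain c where c: "\<And>S. S \<in> J \<Longrightarrow> [v A S = (\<Sum>B\<in>I. c B * v B S)] (mod p)"
    using span by (auto simp: spanned_mod_def)
  have "f A = (\<Sum>S\<in>J. w S * v A S)"
    by (simp add: lin)
  also have "[\<dots> = (\<Sum>S\<in>J. w S * (\<Sum>B\<in>I. c B * v B S))] (mod p)"
    using c by (intro cong_sum cong_mult cong_refl)
  also have "(\<Sum>S\<in>J. w S * (\<Sum>B\<in>I. c B * v B S)) = (\<Sum>S\<in>J. \<Sum>B\<in>I. c B * (w S * v B S))"
    by (simp add: sum_distrib_left mult_ac)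
  also have "\<dots> = (\<Sum>B\<in>I. c B * f B)"
    by (subst sum.swap) (simp add: lin sum_distrib_left)
  finally have "p dvd f A \<longleftrightarrow> p dvd (\<Sum>B\<in>I. c B * f B)"
    by (rule cong_dvd_iff)
  then show False
    using nz zero by (auto intro: dvd_sum)
qed

text \<open>
  The invariant of the exchange is a tuple whose first \<open>j\<close> entries come from \<open>I\<^sub>1, \<dots>, I\<^sub>j\<close> and
  whose other entries all equal the leftover member \<open>A\<close>. Only \<open>k - 1\<close> exchanges are made: the
  last argument keeps the value \<open>A\<close>, which is why the bound has the factor \<open>k - 1\<close>. Linearity
  is only asked for one argument at a time, with the others fixed, so its coefficients \<open>w\<close> may
  depend on the rest of the tuple.
\<close>

lemma nonzero_at_distinct_tuple:
  fixes p :: int and T :: "(nat \<Rightarrow> 'a) \<Rightarrow> int"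
  assumes "prime p" "finite J" "finite F" "k > 0" and large: "card F > (k - 1) * card J"
    and lin: "\<And>i x. i \<in> {1..k} \<Longrightarrow> range x \<subseteq> F \<Longrightarrow>
      \<exists>w. \<forall>B\<in>F. T (x(i := B)) = (\<Sum>S\<in>J. w S * v B S)"
    and diag: "\<And>A. A \<in> F \<Longrightarrow> \<not> p dvd T (\<lambda>_. A)"
  obtains x where "range x \<subseteq> F" "inj_on x {1..k}" "\<not> p dvd T x"
proof -
  obtain A I where A: "A \<in> F"
    and I: "\<And>j. j \<in> {1..k-1} \<Longrightarrow> I j \<subseteq> F - {A}"
      "\<And>j. j \<in> {1..k-1} \<Longrightarrow> spanned_mod p J v (I j) A"
    and disj: "disjoint_family_on I {1..k-1}"
    using disjoint_spanning_subsets[OF assms(1-3) large, of v] by blast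
  have "\<exists>x. (\<forall>i\<in>{1..j}. x i \<in> I i) \<and> (\<forall>i. i \<notin> {1..j} \<longrightarrow> x i = A) \<and> \<not> p dvd T x"
    if "j \<le> k - 1" for j
    using that
  proof (induction j)
    case 0
    then show ?case
      using diag[OF A] by (intro exI[of _ "\<lambda>_. A"]) auto
  next
    case (Suc j)
    from Suc.IH[OF Suc_leD[OF Suc.prems]]
    obtain x where x: "\<And>i. i \<in> {1..j} \<Longrightarrow> x i \<in> I i" "\<And>i. i \<notin> {1..j} \<Longrightarrow> x i = A"
      "\<not> p dvd T x"
      by blast
    have "x i \<in> F" for i
      using x(1,2)[of i] I(1)[of i] A Suc.prems by (cases "i \<in> {1..j}") auto
    then have "range x \<subseteq> F"
      by blast
    then obtain w where w: "\<And>B. B \<in> F \<Longrightarrow> T (x(Suc j := B)) = (\<Sum>S\<in>J. w S * v B S)"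
      using lin[of "Suc j" x] Suc.prems assms(4) by fastforce
    have "x(Suc j := A) = x"
      using x(2)[of "Suc j"] by (simp add: fun_upd_idem)
    moreover have "insert A (I (Suc j)) \<subseteq> F"
      using A I(1)[of "Suc j"] Suc.prems by auto
    ultimately obtain B where B: "B \<in> I (Suc j)" "\<not> p dvd T (x(Suc j := B))"
      using nonzero_at_spanning_set[of A "I (Suc j)" "\<lambda>B. T (x(Suc j := B))" w v J p]
        w I(2)[of "Suc j"] Suc.prems x(3) by (auto simp: subset_iff)
    show ?case
    proof (intro exI conjI)
      show "\<forall>i\<in>{1..Suc j}. (x(Suc j := B)) i \<in> I i"
        using x(1) B(1) by (auto simp: le_Suc_eq)
      show "\<forall>i. i \<notin> {1..Suc j} \<longrightarrow> (x(Suc j := B)) i = A"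
        using x(2) by auto
    qed (fact B(2))
  qed
  from this[OF order_refl] obtain x where x: "\<And>i. i \<in> {1..k-1} \<Longrightarrow> x i \<in> I i"
    "\<And>i. i \<notin> {1..k-1} \<Longrightarrow> x i = A" "\<not> p dvd T x"
    by blast
  have "x i \<in> F" for i
    using x(1,2)[of i] I(1)[of i] A by (cases "i \<in> {1..k-1}") auto
  moreover have "inj_on x {1..k}"
  proof (rule linorder_inj_onI')
    fix i j assume ij: "i \<in> {1..k}" "j \<in> {1..k}" "i < j"
    then have i: "i \<in> {1..k-1}"
      by auto
    show "x i \<noteq> x j"
    proof (cases "j \<in> {1..k-1}")
      case True
      then have "I i \<inter> I j = {}"
        using disj i ij(3) by (auto simp: disjoint_family_on_def)
      then show ?thesis
        using x(1)[OF i] x(1)[OF True] by auto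
    next
      case False
      then show ?thesis
        using x(1)[OF i] x(2) I(1)[OF i] by auto
    qed
  qed
  ultimately show ?thesis
    using that x(3) by blast
qed

section \<open>Polynomial functions of a set\<close>

text \<open>
  These are the polynomials of degree at most \<open>d\<close> in the 0/1 indicator variables of the elements of
  \<open>N\<close>: for such variables every monomial is the indicator \<open>of_bool (S \<subseteq> B)\<close> of a set \<open>S\<close>.
\<close>

definition set_poly :: "'a set \<Rightarrow> nat \<Rightarrow> ('a set \<Rightarrow> int) \<Rightarrow> bool" where
  "set_poly N d f \<longleftrightarrow>
     (\<exists>w. \<forall>B\<subseteq>N. f B = (\<Sum>S | S \<subseteq> N \<and> card S \<le> d. w S * of_bool (S \<subseteq> B)))"

lemma set_poly_cong:
  assumes "set_poly N d f" "\<And>B. B \<subseteq> N \<Longrightarrow> f B = g B"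
  shows "set_poly N d g"
  using assms by (auto simp: set_poly_def)

lemma set_poly_monomial:
  assumes "finite N" "S \<subseteq> N" "card S \<le> d"
  shows "set_poly N d (\<lambda>B. c * of_bool (S \<subseteq> B))"
proof -
  have "(\<Sum>S' | S' \<subseteq> N \<and> card S' \<le> d. (if S' = S then c else 0) * of_bool (S' \<subseteq> B)) =
      (\<Sum>S' | S' \<subseteq> N \<and> card S' \<le> d. if S' = S then c * of_bool (S \<subseteq> B) else 0)" for B
    by (intro sum.cong) auto
  then have "(\<Sum>S' | S' \<subseteq> N \<and> card S' \<le> d. (if S' = S then c else 0) * of_bool (S' \<subseteq> B)) =
      c * of_bool (S \<subseteq> B)" for B
    using assms by simp
  then show ?thesis
    unfolding set_poly_def by (intro exI[of _ "\<lambda>S'. if S' = S then c else 0"]) simp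
qed

lemma set_poly_const:
  assumes "finite N"
  shows "set_poly N d (\<lambda>_. c)"
  using set_poly_monomial[OF assms, of "{}" d c] by simp

lemma set_poly_add:
  assumes "set_poly N d f" "set_poly N d g"
  shows "set_poly N d (\<lambda>B. f B + g B)"
proof -
  obtain u w where
    "\<forall>B\<subseteq>N. f B = (\<Sum>S | S \<subseteq> N \<and> card S \<le> d. u S * of_bool (S \<subseteq> B))"
    "\<forall>B\<subseteq>N. g B = (\<Sum>S | S \<subseteq> N \<and> card S \<le> d. w S * of_bool (S \<subseteq> B))"
    using assms by (auto simp: set_poly_def)
  then show ?thesis
    unfolding set_poly_def
    by (intro exI[of _ "\<lambda>S. u S + w S"]) (simp add: distrib_right sum.distrib)
qed

lemma set_poly_sum:
  assumes "finite N" "\<And>t. t \<in> M \<Longrightarrow> set_poly N d (f t)"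
  shows "set_poly N d (\<lambda>B. \<Sum>t\<in>M. f t B)"
  using assms(2)
  by (induction M rule: infinite_finite_induct)
    (auto intro: set_poly_add set_poly_const[OF assms(1)])

lemma set_poly_mult:
  assumes "finite N" "set_poly N d f" "set_poly N e g"
  shows "set_poly N (d + e) (\<lambda>B. f B * g B)"
proof -
  obtain u w where uw:
    "\<forall>B\<subseteq>N. f B = (\<Sum>S | S \<subseteq> N \<and> card S \<le> d. u S * of_bool (S \<subseteq> B))"
    "\<forall>B\<subseteq>N. g B = (\<Sum>S | S \<subseteq> N \<and> card S \<le> e. w S * of_bool (S \<subseteq> B))"
    using assms by (auto simp: set_poly_def)
  have "set_poly N (d + e) (\<lambda>B. u S * w S' * of_bool (S \<union> S' \<subseteq> B))"
    if "S \<subseteq> N \<and> card S \<le> d" "S' \<subseteq> N \<and> card S' \<le> e" for S S'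
  proof (rule set_poly_monomial[OF assms(1)])
    show "card (S \<union> S') \<le> d + e"
      using that card_Un_le[of S S'] by linarith
  qed (use that in auto)
  then have "set_poly N (d + e) (\<lambda>B. \<Sum>S | S \<subseteq> N \<and> card S \<le> d.
      \<Sum>S' | S' \<subseteq> N \<and> card S' \<le> e. u S * w S' * of_bool (S \<union> S' \<subseteq> B))"
    by (intro set_poly_sum assms(1)) auto
  then show ?thesis
    by (rule set_poly_cong) (simp add: uw sum_product of_bool_conj mult_ac)
qed

lemma set_poly_prod:
  assumes "finite N" "\<And>t. t \<in> M \<Longrightarrow> set_poly N (d t) (f t)"
  shows "set_poly N (\<Sum>t\<in>M. d t) (\<lambda>B. \<Prod>t\<in>M. f t B)"
  using assms(2)
  by (induction M rule: infinite_finite_induct)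
    (auto intro: set_poly_mult[OF assms(1)] set_poly_const[OF assms(1)])

lemma set_poly_mono:
  assumes "finite N" "set_poly N d f" "d \<le> e"
  shows "set_poly N e f"
  using set_poly_mult[OF assms(1,2) set_poly_const[OF assms(1), of "e - d" 1]] assms(3) by simp

lemma set_poly_card_Int:
  assumes "finite N"
  shows "set_poly N 1 (\<lambda>B. int (card (B \<inter> R)))"
proof (rule set_poly_cong)
  show "set_poly N 1 (\<lambda>B. \<Sum>t\<in>N \<inter> R. 1 * of_bool ({t} \<subseteq> B))"
    by (intro set_poly_sum set_poly_monomial assms) auto
  show "(\<Sum>t\<in>N \<inter> R. 1 * of_bool ({t} \<subseteq> B)) = int (card (B \<inter> R))" if "B \<subseteq> N" for B
  proof -
    have "N \<inter> R \<inter> B = B \<inter> R"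
      using that by blast
    then show ?thesis
      using assms by (simp add: sum_of_bool_eq Int_def conj_ac)
  qed
qed

lemma card_subsets_card_le:
  assumes "finite N"
  shows "card {S. S \<subseteq> N \<and> card S \<le> d} = (\<Sum>s = 0..d. card N choose s)"
proof -
  have "{S. S \<subseteq> N \<and> card S \<le> d} = (\<Union>s\<in>{0..d}. {S. S \<subseteq> N \<and> card S = s})"
    by auto
  also have "card \<dots> = (\<Sum>s = 0..d. card {S. S \<subseteq> N \<and> card S = s})"
    using assms by (intro card_UN_disjoint) auto
  finally show ?thesis
    using assms by (simp add: n_subsets)
qed

section \<open>The polynomial of a configuration\<close>

text \<open>
  The empty index set is left out since it imposes no condition on the chosen sets; as
  \<open>(\<Inter>i\<in>{}. x i)\<close> is infinite, it would contribute factors \<open>- l\<close>, which vanish if \<open>0 \<in> L\<close>.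
\<close>

definition config_poly :: "nat set set \<Rightarrow> nat set \<Rightarrow> (nat \<Rightarrow> nat set) \<Rightarrow> int" where
  "config_poly C L x = (\<Prod>X\<in>C - {{}}. \<Prod>l\<in>L. int (card (\<Inter>i\<in>X. x i)) - int l)"

lemma config_poly_nonzero_iff:
  assumes "prime p" "finite C" "L \<subseteq> {0..<p}"
  shows "\<not> int p dvd config_poly C L x \<longleftrightarrow>
    (\<forall>X\<in>C. X \<noteq> {} \<longrightarrow> card (\<Inter>i\<in>X. x i) mod p \<notin> L)"
proof -
  have "finite L"
    using assms(3) finite_subset by blast
  have root: "int p dvd int c - int l \<longleftrightarrow> c mod p = l" if "l \<in> L" for c l
    using that assms(3) by (auto simp flip: mod_eq_dvd_iff of_nat_mod)
  have "prime (int p)"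
    using assms(1) by simp
  then have "int p dvd config_poly C L x \<longleftrightarrow>
      (\<exists>X\<in>C - {{}}. \<exists>l\<in>L. int p dvd int (card (\<Inter>i\<in>X. x i)) - int l)"
    using assms(2) \<open>finite L\<close> by (simp add: config_poly_def prime_dvd_prod_iff)
  then show ?thesis
    using root by auto
qed

text \<open>
  The \<open>i\<close>-th argument only enters the factors with \<open>i \<in> X\<close>. There are \<open>degree C i\<close> such
  \<open>X\<close>, and each contributes \<open>card L\<close> factors that are linear in the indicator variables.
\<close>

lemma set_poly_config_poly:
  assumes "finite N" "finite C"
  shows "set_poly N (degree C i * card L) (\<lambda>B. config_poly C L (x(i := B)))"
proof -
  let ?e = "\<lambda>X. of_bool (i \<in> X) :: nat"
  have factor: "set_poly N (?e X) (\<lambda>B. int (card (\<Inter>j\<in>X. (x(i := B)) j)) - int l)" for X l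
  proof (cases "i \<in> X")
    case True
    have "(\<Inter>j\<in>X. (x(i := B)) j) = B \<inter> (\<Inter>j\<in>X - {i}. x j)" for B
      using True by (auto split: if_splits)
    then show ?thesis
      using True set_poly_add[OF set_poly_card_Int set_poly_const, OF assms(1,1), of _ "- int l"]
      by simp
  next
    case False
    then have "(\<Inter>j\<in>X. (x(i := B)) j) = (\<Inter>j\<in>X. x j)" for B
      by auto
    then show ?thesis
      using set_poly_const[OF assms(1)] by simp
  qed
  have "set_poly N (\<Sum>X\<in>C - {{}}. \<Sum>l\<in>L. ?e X) (\<lambda>B. config_poly C L (x(i := B)))"
    unfolding config_poly_def by (intro set_poly_prod assms(1) factor)
  moreover have "(\<Sum>X\<in>C - {{}}. \<Sum>l\<in>L. ?e X) = degree C i * card L"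
  proof -
    have "(\<Sum>X\<in>C - {{}}. ?e X) = card ((C - {{}}) \<inter> {X. i \<in> X})"
      using assms(2) by (simp add: sum_of_bool_eq)
    also have "(C - {{}}) \<inter> {X. i \<in> X} = {X \<in> C. i \<in> X}"
      by auto
    finally show ?thesis
      by (simp add: degree_def mult.commute flip: sum_distrib_left)
  qed
  ultimately show ?thesis
    by simp
qed

theorem theorem7:
  fixes p k n :: nat and C :: "nat set set" and L :: "nat set" and F :: "nat set set"
  assumes "prime p" and "k > 0" and "n > 0"
    and "configuration p k C L"
    and "F \<subseteq> Pow {1..n}"
    and "satisfying p k C L F"
  shows "card F \<le> (k - 1) * (\<Sum>s = 0..max_degree k C * card L. n choose s)"
proof (rule ccontr)
  let ?d = "max_degree k C * card L"
  let ?J = "{S. S \<subseteq> {1..n} \<and> card S \<le> ?d}"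
  assume "\<not> ?thesis"
  then have large: "card F > (k - 1) * card ?J"
    by (simp add: card_subsets_card_le)
  have C: "C \<subseteq> Pow {1..k}" and L: "L \<subseteq> {0..<p}"
    using assms(4) by (auto simp: configuration_def)
  have finC: "finite C"
    using C finite_subset by blast
  note nonzero = config_poly_nonzero_iff[OF assms(1) finC L]
  have finF: "finite F"
    using assms(5) finite_subset by blast
  have lin: "\<exists>w. \<forall>B\<in>F. config_poly C L (x(i := B)) = (\<Sum>S\<in>?J. w S * of_bool (S \<subseteq> B))"
    if "i \<in> {1..k}" for i x
  proof -
    have "degree C i \<le> max_degree k C"
      using that by (simp add: max_degree_def)
    then have "set_poly {1..n} ?d (\<lambda>B. config_poly C L (x(i := B)))"
      using set_poly_mono[OF _ set_poly_config_poly[OF _ finC]] by simp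
    then obtain w where
      "\<forall>B\<subseteq>{1..n}. config_poly C L (x(i := B)) = (\<Sum>S\<in>?J. w S * of_bool (S \<subseteq> B))"
      unfolding set_poly_def by (rule exE)
    then show ?thesis
      using assms(5) by (intro exI[of _ w]) auto
  qed
  have diag: "\<not> int p dvd config_poly C L (\<lambda>_. A)" if "A \<in> F" for A
    using assms(6) that by (simp add: nonzero satisfying_def)
  have "prime (int p)"
    using assms(1) by simp
  then obtain x where x: "range x \<subseteq> F" "inj_on x {1..k}" "\<not> int p dvd config_poly C L x"
    using nonzero_at_distinct_tuple[of "int p" ?J F k "config_poly C L" "\<lambda>B S. of_bool (S \<subseteq> B)"]
      finF assms(2) large lin diag by auto
  from x(1) have "\<forall>i\<in>{1..k}. x i \<in> F"
    by blast
  then show False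
    using assms(6) x(2,3) unfolding nonzero satisfying_def by blast
qed

end
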